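(* Let $\hat{\mathbf h}$ be the logit-based stochastic user equilibrium (SUE) path flow, i.e. the feasible path flow vector with $\hat{\mathbf h}=\mathcal{L}(\hat{\mathbf h})$, and let $\{\mathbf h^k\}$ be the sequence generated by the method of successive averages $\mathbf h^{k+1}=(1-s_k)\mathbf h^k+s_k\mathcal{L}(\mathbf h^k)$ with the adaptive constant step-size (ACS) rule, starting from any feasible path flow vector. Suppose the gap function $g$ used in the ACS rule satisfies: (i) $g(\mathbf h)\ge 0$ for all feasible $\mathbf h$, with $g(\mathbf h)=0$ if and only if $\mathbf h=\hat{\mathbf h}$; (ii) $g$ is continuous. Then for any parameters $\epsilon\in(0,1)$, $q>1$ and $I_s>1$ (with $q,I_s$ integers) of the ACS rule, the sequence $\{\mathbf h^k\}$ converges to $\hat{\mathbf h}$.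
   Context: Network setting. There is a finite set $\mathbb{L}$ of links and a finite nonempty set of origin-destination (OD) pairs. Each OD pair has a demand $d_{OD}\ge 0$ and a fixed finite nonempty set $\mathbb{P}_{OD}$ of acyclic paths; $\mathbb{P}$ is the disjoint union of the $\mathbb{P}_{OD}$, $n=|\mathbb{P}|$, and $OD(i)$ is the OD pair of path $i$. $\mathbf{D}\in\{0,1\}^{|\mathbb{L}|\times n}$ is the link-path incidence matrix ($D_{li}=1$ iff link $l$ is on path $i$). A vector $\mathbf{h}\in\mathbb{R}^n$ is a feasible path flow vector if $h_i\ge 0$ for all $i$ and $\sum_{i\in\mathbb{P}_{OD}}h_i=d_{OD}$ for every OD pair. Costs. The cost of link $l$ depends only on its own flow $a_l$ via $\tau_l:[0,\infty)\to[0,\infty)$, which is twice continuously differentiable and monotone non-decreasing, with $\tau_l'$ Lipschitz on the bounded set of link flows arising from feasible path flows. Path costs are $\mathcal{C}(\mathbf h)=\mathbf{D}^T\mathcal{T}(\mathbf{D}\mathbf{h})$ with $\mathcal{T}_l(\mathbf a)=\tau_l(a_l)$. Logit model. $\theta>0$ is a fixed parameter. $\mathcal{P}(\mathbf c)_i=\exp(-\theta c_i)/\sum_{i'\in\mathbb{P}_{OD(i)}}\exp(-\theta c_{i'})$, and the logit mapping is $\mathcal{L}(\mathbf h)_i=\bigl(\sum_{i'\in\mathbb{P}_{OD(i)}}h_{i'}\bigr)\mathcal{P}(\mathcal{C}(\mathbf h))_i$. It is known (Fisk) that the feasible fixed point $\hat{\mathbf h}$ of $\mathcal{L}$ exists and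 is unique. ACS step-size rule. Parameters: $\epsilon\in(0,1)$, integers $q>1$, $I_s>1$, and a real-valued gap function $g$ on feasible path flow vectors. Iterations are numbered $k=1,2,3,\dots$, with $\mathbf h^1$ the initial feasible vector; write $g_k=g(\mathbf h^k)$. For $k\le I_s$, $s_k=1/k$. For $k>I_s$: if the reset condition $\dfrac{g_{k-q+1}-g_k}{g_{k-q+1}}<\epsilon$ holds then $s_k=1/k$; otherwise $s_k=s_{k-1}$. (The reset condition compares the oldest and newest of the last $q$ gap values; it is only tested when $q$ gap values are available, i.e. $k\ge q$. If some $g_k=0$ then $\mathbf h^k=\hat{\mathbf h}$ and the iterates remain there.) *)

theory Defs
  imports "HOL-Analysis.Analysis" "Graph_Theory.Arc_Walk"
begin

text \<open>
  The finite types \<open>'l\<close> and \<open>'p\<close> are the link set and the path index set, i.e. the disjoint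
  union of the path sets of the OD pairs: path \<open>i\<close> serves the OD pair \<open>od i\<close> and traverses
  the list of links \<open>links i\<close>.
\<close>

definition incidence :: "('p::finite \<Rightarrow> 'l::finite list) \<Rightarrow> real ^ 'p ^ 'l" where
  "incidence links = (\<chi> l i. if l \<in> set (links i) then 1 else 0)"

definition feasible :: "('p::finite \<Rightarrow> 'w) \<Rightarrow> 'w set \<Rightarrow> ('w \<Rightarrow> real) \<Rightarrow> (real ^ 'p) set" where
  "feasible od W d =
     {h. (\<forall>i. h $ i \<ge> 0) \<and> (\<forall>w\<in>W. (\<Sum>i | od i = w. h $ i) = d w)}"

definition path_costs ::
  "('p::finite \<Rightarrow> 'l::finite list) \<Rightarrow> ('l \<Rightarrow> real \<Rightarrow> real) \<Rightarrow> real ^ 'p \<Rightarrow> real ^ 'p" where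
  "path_costs links \<tau> h =
     transpose (incidence links) *v (\<chi> l. \<tau> l ((incidence links *v h) $ l))"

definition logit_prob :: "('p::finite \<Rightarrow> 'w) \<Rightarrow> real \<Rightarrow> real ^ 'p \<Rightarrow> real ^ 'p" where
  "logit_prob od \<theta> c =
     (\<chi> i. exp (- \<theta> * c $ i) / (\<Sum>j | od j = od i. exp (- \<theta> * c $ j)))"

definition logit_map ::
  "('p::finite \<Rightarrow> 'l::finite list) \<Rightarrow> ('p \<Rightarrow> 'w) \<Rightarrow> ('l \<Rightarrow> real \<Rightarrow> real) \<Rightarrow> real
     \<Rightarrow> real ^ 'p \<Rightarrow> real ^ 'p" where
  "logit_map links od \<tau> \<theta> h =
     (\<chi> i. (\<Sum>j | od j = od i. h $ j) * logit_prob od \<theta> (path_costs links \<tau> h) $ i)"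

text \<open>
  \<open>od_surj\<close> says that every OD pair has at least one path; as types are nonempty, it also
  makes \<open>W\<close> nonempty and finite. \<open>path_inj\<close> says that the paths of one OD pair form a set.
  Derivatives within \<open>{0..}\<close> are one-sided at \<open>0\<close>; values of \<open>\<tau> l\<close> at negative arguments
  are irrelevant.
\<close>

locale road_network = wf_digraph G
  for G :: "('v, 'l::finite) pre_digraph" +
  fixes W :: "('v \<times> 'v) set"
    and d :: "'v \<times> 'v \<Rightarrow> real"
    and od :: "'p::finite \<Rightarrow> 'v \<times> 'v"
    and links :: "'p \<Rightarrow> 'l list"
    and \<tau> :: "'l \<Rightarrow> real \<Rightarrow> real"
  assumes arcs_UNIV: "arcs G = UNIV"
    and od_surj: "range od = W"
    and path_inj: "inj (\<lambda>i. (od i, links i))"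
    and path_acyclic: "apath (fst (od i)) (links i) (snd (od i))"
    and demand_nonneg: "w \<in> W \<Longrightarrow> d w \<ge> 0"
    and cost_nonneg: "x \<ge> 0 \<Longrightarrow> \<tau> l x \<ge> 0"
    and cost_mono: "mono_on {0..} (\<tau> l)"
    and cost_C2: "\<exists>\<tau>' \<tau>''.
      (\<forall>x\<ge>0. (\<tau> l has_real_derivative \<tau>' x) (at x within {0..})) \<and>
      (\<forall>x\<ge>0. (\<tau>' has_real_derivative \<tau>'' x) (at x within {0..})) \<and>
      continuous_on {0..} \<tau>'' \<and>
      (\<exists>K. K-lipschitz_on ((\<lambda>h. (incidence links *v h) $ l) ` feasible od W d) \<tau>')"

definition is_sue ::
  "('p::finite \<Rightarrow> 'l::finite list) \<Rightarrow> ('p \<Rightarrow> 'w) \<Rightarrow> 'w set \<Rightarrow> ('w \<Rightarrow> real)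
     \<Rightarrow> ('l \<Rightarrow> real \<Rightarrow> real) \<Rightarrow> real \<Rightarrow> real ^ 'p \<Rightarrow> bool" where
  "is_sue links od W d \<tau> \<theta> h \<longleftrightarrow> h \<in> feasible od W d \<and> h = logit_map links od \<tau> \<theta> h"

text \<open>
  Iterations are numbered from \<open>1\<close>, and \<open>\<gamma> k\<close> is the gap at iteration \<open>k\<close>. The index
  \<open>k + 1 - q\<close> is \<open>k - q + 1\<close> without truncation, since \<open>q \<le> k\<close>. If the oldest gap is \<open>0\<close>,
  the quotient is \<open>0\<close> by convention and the step size is reset; this has no effect on the iterates,
  which have already reached the equilibrium and stay there.
\<close>

definition acs_reset :: "real \<Rightarrow> nat \<Rightarrow> (nat \<Rightarrow> real) \<Rightarrow> nat \<Rightarrow> bool" where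
  "acs_reset \<epsilon> q \<gamma> k \<longleftrightarrow>
     q \<le> k \<and> (\<gamma> (k + 1 - q) - \<gamma> k) / \<gamma> (k + 1 - q) < \<epsilon>"

definition acs_step_sizes ::
  "real \<Rightarrow> nat \<Rightarrow> nat \<Rightarrow> (nat \<Rightarrow> real) \<Rightarrow> (nat \<Rightarrow> real) \<Rightarrow> bool" where
  "acs_step_sizes \<epsilon> q I\<^sub>s \<gamma> s \<longleftrightarrow>
     (\<forall>k\<ge>1. s k = (if k \<le> I\<^sub>s \<or> acs_reset \<epsilon> q \<gamma> k then 1 / real k else s (k - 1)))"

definition msa_iterates ::
  "('a::real_vector \<Rightarrow> 'a) \<Rightarrow> (nat \<Rightarrow> real) \<Rightarrow> (nat \<Rightarrow> 'a) \<Rightarrow> bool" where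
  "msa_iterates F s h \<longleftrightarrow> (\<forall>k\<ge>1. h (k + 1) = (1 - s k) *\<^sub>R h k + s k *\<^sub>R F (h k))"

end

theory Submission
  imports Defs "HOL-Real_Asymp.Real_Asymp"
begin

text \<open>
  If the step size is reset only finitely often, the gap is eventually multiplied by at most
  \<open>1 - \<epsilon>\<close> every \<open>q - 1\<close> iterations, hence tends to \<open>0\<close>, and compactness of the feasible set gives
  convergence. Otherwise \<open>s k\<close> tends to \<open>0\<close>, while \<open>1 / k \<le> s k\<close> makes its sum diverge. In
  that case we use Fisk's objective \<open>Z = \<Phi> + R\<close>, where \<open>\<Phi>\<close> is the Beckmann potential, with gradient \<open>C\<close>
  (the path costs), and \<open>R\<close> is the negative entropy divided by \<open>\<theta>\<close>. The logit flow at \<open>h\<close> is the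
  unique minimizer of \<open>C h \<bullet> z + R z\<close> over feasible \<open>z\<close>, so the method is a generalized
  conditional gradient method for \<open>Z\<close>. Convexity of \<open>\<Phi>\<close> and \<open>R\<close> gives
  \<open>u (k + 1) \<le> (1 - s k) * u k + s k * e k\<close> for the excess \<open>u\<close> of \<open>Z\<close> over its minimum, with
  \<open>e\<close> tending to \<open>0\<close> by uniform continuity of \<open>C\<close>. No derivative of \<open>R\<close> is used, so its infinite slope
  at the boundary is harmless.
\<close>

section \<open>Two criteria for convergence\<close>

text \<open>While \<open>u\<close> stays above \<open>r / 2\<close> and \<open>e\<close> below
  \<open>r / 4\<close>, each step lowers \<open>u\<close> by at least \<open>s k * (r / 4)\<close>,
  which a divergent sum cannot allow forever. Once \<open>u\<close> is at most \<open>r / 2\<close>,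
  averaging with values \<open>e k\<close> below that level keeps it there.\<close>

lemma tendsto_zero_of_averaging:
  fixes u s e :: "nat \<Rightarrow> real"
  assumes s01: "\<And>k. 0 \<le> s k" "\<And>k. s k \<le> 1" and div: "\<not> summable s" and e: "e \<longlonglongrightarrow> 0"
    and u0: "\<And>k. 0 \<le> u k" and rec: "\<And>k. u (Suc k) \<le> (1 - s k) * u k + s k * e k"
  shows "u \<longlonglongrightarrow> 0"
proof (rule LIMSEQ_I)
  fix r :: real assume r: "0 < r"
  have "\<forall>\<^sub>F k in sequentially. e k < r / 4"
    using e r by (intro order_tendstoD) auto
  then obtain N where N: "\<And>k. k \<ge> N \<Longrightarrow> e k \<le> r / 4"
    unfolding eventually_sequentially by force
  have "\<exists>k\<ge>N. u k \<le> r / 2"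
  proof (rule ccontr)
    assume "\<not> ?thesis"
    then have big: "r / 2 \<le> u k" if "k \<ge> N" for k using that by force
    have drop: "s (n + N) * (r / 4) \<le> u (n + N) - u (Suc n + N)" for n
    proof -
      have "s (n + N) * (r / 4) \<le> s (n + N) * (u (n + N) - e (n + N))"
        using big[of "n + N"] N[of "n + N"] s01 by (intro mult_left_mono) auto
      then show ?thesis using rec[of "n + N"] by (simp add: algebra_simps)
    qed
    have telescope: "(\<Sum>i<n. s (i + N)) * (r / 4) \<le> u N - u (n + N)" for n
    proof (induction n)
      case (Suc n)
      then show ?case using drop[of n] by (simp add: algebra_simps)
    qed simp
    have "(\<Sum>i<n. s (i + N)) * (r / 4) \<le> u N" for n
      using telescope[of n] u0[of "n + N"] by linarith
    then have "(\<Sum>i<n. s (i + N)) \<le> u N / (r / 4)" for n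
      using r by (simp add: field_simps)
    then have "summable (\<lambda>i. s (i + N))"
      by (intro summableI_nonneg_bounded) (use s01 in auto)
    then show False using div by (simp add: summable_iff_shift)
  qed
  then obtain M where M: "M \<ge> N" "u M \<le> r / 2" by blast
  have "u k \<le> r / 2" if "k \<ge> M" for k
    using that
  proof (induction k rule: dec_induct)
    case (step k)
    have "u (Suc k) \<le> (1 - s k) * (r / 2) + s k * (r / 2)"
    proof (rule order_trans[OF rec add_mono])
      show "(1 - s k) * u k \<le> (1 - s k) * (r / 2)"
        using step s01 by (intro mult_left_mono) auto
      show "s k * e k \<le> s k * (r / 2)"
        using N[of k] step M s01 r by (intro mult_left_mono) auto
    qed
    also have "\<dots> = r / 2" by (simp add: field_simps)
    finally show ?case .
  qed (use M in auto)
  then have "norm (u k - 0) < r" if "k \<ge> M" for k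
    using that u0[of k] r by fastforce
  then show "\<exists>no. \<forall>n\<ge>no. norm (u n - 0) < r" by blast
qed

text \<open>The part of \<open>X\<close> off a ball around \<open>a\<close> is compact, so
  \<open>B\<close> is bounded away from 0 there. Serves both the linearized objective and the gap
  function.\<close>

lemma tendsto_of_gap_tendsto_zero:
  fixes B :: "'a::metric_space \<Rightarrow> real"
  assumes X: "compact X" and cont: "continuous_on X B"
    and pos: "\<And>z. z \<in> X \<Longrightarrow> z \<noteq> a \<Longrightarrow> 0 < B z"
    and x: "\<And>k. x k \<in> X" and lim: "(\<lambda>k. B (x k)) \<longlonglongrightarrow> 0"
  shows "x \<longlonglongrightarrow> a"
proof (rule metric_LIMSEQ_I)
  fix r :: real assume r: "0 < r"
  define K where "K = X - ball a r"
  have K: "compact K" "continuous_on K B"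
    unfolding K_def using X cont by (auto intro: compact_diff continuous_on_subset)
  show "\<exists>no. \<forall>n\<ge>no. dist (x n) a < r"
  proof (cases "K = {}")
    case True
    then have "dist (x n) a < r" for n
      using x[of n] unfolding K_def by (auto simp: dist_commute)
    then show ?thesis by blast
  next
    case False
    then obtain z where z: "z \<in> K" "\<And>y. y \<in> K \<Longrightarrow> B z \<le> B y"
      using continuous_attains_inf[OF K(1) _ K(2)] by blast
    then have "z \<in> X" "z \<noteq> a" using r unfolding K_def by auto
    then have "0 < B z" by (rule pos)
    from LIMSEQ_D[OF lim this] obtain N where N: "\<And>n. n \<ge> N \<Longrightarrow> B (x n) < B z"
      by (auto simp: abs_less_iff)
    have "x n \<in> ball a r" if "n \<ge> N" for n
      using N[OF that] z(2)[of "x n"] x[of n] unfolding K_def by force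
    then show ?thesis by (auto simp: dist_commute)
  qed
qed

section \<open>Generalized conditional gradient method\<close>

text \<open>Decay of the excess \<open>u\<close> becomes convergence of the points through
  \<open>B\<close>, which lies below \<open>u\<close>, is continuous, and by \<open>opt\<close> is
  positive on \<open>X\<close> away from \<open>xs\<close>.\<close>

lemma generalized_conditional_gradient:
  fixes X :: "'a::euclidean_space set" and C F :: "'a \<Rightarrow> 'a" and \<Phi> R :: "'a \<Rightarrow> real"
  assumes X: "compact X" and C: "continuous_on X C"
    and grad: "\<And>a b. a \<in> X \<Longrightarrow> b \<in> X \<Longrightarrow> C a \<bullet> (b - a) \<le> \<Phi> b - \<Phi> a"
    and R: "convex_on X R" "continuous_on X R"
    and F: "\<And>a. a \<in> X \<Longrightarrow> F a \<in> X"
    and F_min: "\<And>a b. a \<in> X \<Longrightarrow> b \<in> X \<Longrightarrow> C a \<bullet> F a + R (F a) \<le> C a \<bullet> b + R b"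
    and opt: "xs \<in> X" "\<And>b. b \<in> X \<Longrightarrow> b \<noteq> xs \<Longrightarrow> C xs \<bullet> xs + R xs < C xs \<bullet> b + R b"
    and s: "\<And>k. 0 \<le> s k" "\<And>k. s k \<le> 1" "s \<longlonglongrightarrow> 0" "\<not> summable s"
    and x: "\<And>k. x k \<in> X" "\<And>k. x (Suc k) = (1 - s k) *\<^sub>R x k + s k *\<^sub>R F (x k)"
  shows "x \<longlonglongrightarrow> xs"
proof -
  \<comment> \<open>The excess of the objective with \<open>\<Phi>\<close> linearized at
    \<open>xs\<close>.\<close>
  define B where "B z = C xs \<bullet> (z - xs) + R z - R xs" for z
  define u where "u k = \<Phi> (x k) + R (x k) - \<Phi> xs - R xs" for k
  \<comment> \<open>The error of using the gradient at the old point instead of the new one.\<close>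
  define e where "e k = (C (x (Suc k)) - C (x k)) \<bullet> (F (x k) - x k)" for k
  have B0: "0 \<le> B z" if "z \<in> X" for z
    using opt(2)[OF that] by (cases "z = xs") (auto simp: B_def inner_diff_right)
  have Bu: "B (x k) \<le> u k" for k
    using grad[OF opt(1) x(1)[of k]] by (simp add: B_def u_def)
  have step: "x (Suc k) - x k = s k *\<^sub>R (F (x k) - x k)" for k
    by (simp add: x(2) algebra_simps)
  obtain D where D: "\<And>a b. a \<in> X \<Longrightarrow> b \<in> X \<Longrightarrow> norm (a - b) \<le> D"
    using compact_imp_bounded[OF X] unfolding bounded_two_points dist_norm by blast
  have "(\<lambda>k. dist (x (Suc k)) (x k)) \<longlonglongrightarrow> 0"
  proof (rule Lim_null_comparison[where g = "\<lambda>k. s k * D"])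
    show "\<forall>\<^sub>F k in sequentially. norm (dist (x (Suc k)) (x k)) \<le> s k * D"
      using s(1) D[OF F[OF x(1)] x(1)] by (auto simp: dist_norm step intro!: always_eventually mult_left_mono)
    show "(\<lambda>k. s k * D) \<longlonglongrightarrow> 0" using tendsto_mult_left_zero[OF s(3)] .
  qed
  moreover have "uniformly_continuous_on X C"
    by (rule compact_uniformly_continuous[OF C X])
  ultimately have CC: "(\<lambda>k. dist (C (x (Suc k))) (C (x k))) \<longlonglongrightarrow> 0"
    using x(1) unfolding uniformly_continuous_on_sequentially
    by (elim allE[of _ "\<lambda>k. x (Suc k)"] allE[of _ x]) simp
  have "e \<longlonglongrightarrow> 0"
  proof (rule Lim_null_comparison[where g = "\<lambda>k. dist (C (x (Suc k))) (C (x k)) * D"])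
    have "norm (e k) \<le> dist (C (x (Suc k))) (C (x k)) * D" for k
      unfolding e_def dist_norm real_norm_def
      by (rule order_trans[OF Cauchy_Schwarz_ineq2 mult_left_mono[OF D[OF F[OF x(1)] x(1)]]]) simp
    then show "\<forall>\<^sub>F k in sequentially. norm (e k) \<le> dist (C (x (Suc k))) (C (x k)) * D" by simp
    show "(\<lambda>k. dist (C (x (Suc k))) (C (x k)) * D) \<longlonglongrightarrow> 0" using tendsto_mult_left_zero[OF CC] .
  qed
  moreover have "u (Suc k) \<le> (1 - s k) * u k + s k * e k" for k
  proof -
    let ?a = "x k" and ?b = "x (Suc k)" and ?y = "F (x k)"
    \<comment> \<open>Taking the new point \<open>?b\<close> as base point turns \<open>grad\<close>
      into an upper bound; \<open>C ?b\<close> is then split into \<open>C ?a\<close> and the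
      error.\<close>
    have "\<Phi> ?b - \<Phi> ?a \<le> C ?b \<bullet> (?b - ?a)"
      using grad[OF x(1)[of "Suc k"] x(1)[of k]] by (simp add: inner_diff_right)
    also have "\<dots> = s k * (C ?a \<bullet> (?y - ?a)) + s k * e k"
      by (simp only: step e_def) (simp add: inner_diff_left inner_diff_right algebra_simps)
    \<comment> \<open>Optimality of \<open>?y\<close> is tested against \<open>xs\<close>, and
      convexity of \<open>\<Phi>\<close> removes the remaining linear term.\<close>
    also have "C ?a \<bullet> (?y - ?a) \<le> \<Phi> xs - \<Phi> ?a + R xs - R ?y"
      using F_min[OF x(1)[of k] opt(1)] grad[OF x(1)[of k] opt(1)] by (simp add: inner_diff_right)
    finally have 1: "\<Phi> ?b - \<Phi> ?a \<le> s k * (\<Phi> xs - \<Phi> ?a + R xs - R ?y) + s k * e k"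
      using s(1) by (simp add: mult_left_mono)
    have "R ?b \<le> (1 - s k) * R ?a + s k * R ?y"
      unfolding x(2) by (rule convex_onD[OF R(1) s(1,2) x(1) F[OF x(1)]])
    with 1 show ?thesis by (simp add: u_def algebra_simps)
  qed
  ultimately have "u \<longlonglongrightarrow> 0"
    using order_trans[OF B0[OF x(1)] Bu] tendsto_zero_of_averaging[OF s(1,2,4), of e u] by simp
  then have "(\<lambda>k. B (x k)) \<longlonglongrightarrow> 0"
    by (rule Lim_null_comparison[rotated]) (use B0[OF x(1)] Bu in auto)
  moreover have "continuous_on X B"
    unfolding B_def by (intro continuous_intros R)
  moreover have "0 < B z" if "z \<in> X" "z \<noteq> xs" for z
    using opt(2)[OF that] by (simp add: B_def inner_diff_right)
  ultimately show ?thesis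
    using X x(1) by (intro tendsto_of_gap_tendsto_zero[where B = B])
qed

section \<open>The function x ln x\<close>

text \<open>The left side is the tangent of x ln x at \<open>y\<close>, evaluated at
  \<open>z\<close>; the gap comes from ln t < t - 1 at t = \<open>y / z\<close>.\<close>

lemma mult_ln_gt:
  fixes z y :: real
  assumes "0 \<le> z" "0 < y" "z \<noteq> y"
  shows "z * ln y + z - y < z * ln z"
proof (cases "z = 0")
  case False
  then have "ln (y / z) < y / z - 1"
    using assms ln_le_minus_one[of "y / z"] ln_eq_minus_one[of "y / z"] by fastforce
  then have "z * ln (y / z) < z * (y / z - 1)" using assms False by (intro mult_strict_left_mono) auto
  then show ?thesis using False assms by (simp add: ln_div algebra_simps)
qed (use assms in auto)

lemma mult_ln_ge:
  fixes z y :: real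
  assumes "0 \<le> z" "0 < y"
  shows "z * ln y + z - y \<le> z * ln z"
  using mult_ln_gt[OF assms] by (cases "z = y") auto

text \<open>Averaging the tangent inequalities at the mean \<open>?m\<close> cancels the linear
  terms. Tangents need \<open>?m\<close> positive, hence the separate case of two zeros.\<close>

lemma mult_ln_convex: "convex_on {0..} (\<lambda>x::real. x * ln x)"
proof (rule convex_onI)
  fix t x y :: real
  assume t: "0 < t" "t < 1" and xy: "x \<in> {0..}" "y \<in> {0..}"
  let ?m = "(1 - t) * x + t * y"
  show "((1 - t) *\<^sub>R x + t *\<^sub>R y) * ln ((1 - t) *\<^sub>R x + t *\<^sub>R y)
          \<le> (1 - t) * (x * ln x) + t * (y * ln y)"
  proof (cases "x = 0 \<and> y = 0")
    case False
    then have m: "0 < ?m" using t xy by (auto simp: add_pos_nonneg add_nonneg_pos)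
    have "(1 - t) * (x * ln ?m + x - ?m) + t * (y * ln ?m + y - ?m)
            \<le> (1 - t) * (x * ln x) + t * (y * ln y)"
      using t xy m by (intro add_mono mult_left_mono mult_ln_ge) auto
    moreover have "(1 - t) * (x * L + x - ?m) + t * (y * L + y - ?m) = ?m * L" for L
      by (simp add: algebra_simps)
    ultimately show ?thesis by simp
  qed auto
qed simp

lemma mult_ln_continuous: "continuous_on {0..} (\<lambda>x::real. x * ln x)"
proof -
  have "((\<lambda>x::real. x * ln x) \<longlongrightarrow> 0 * ln 0) (at 0 within {0..})"
  proof -
    have "((\<lambda>x::real. x * ln x) \<longlongrightarrow> 0) (at_right 0)" by real_asymp
    moreover have "at (0::real) within {0..} = at_right 0" by (simp add: at_within_Ici_at_right)
    ultimately show ?thesis by simp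
  qed
  moreover have "((\<lambda>x::real. x * ln x) \<longlongrightarrow> x * ln x) (at x within {0..})" if "0 < x" for x
    using that by (intro tendsto_intros) auto
  ultimately show ?thesis by (auto simp: continuous_on_def order_le_less)
qed

section \<open>Step sizes and gaps under the ACS rule\<close>

text \<open>The witness \<open>j\<close> is the last iteration at which the step size was set rather
  than kept; iteration 1 always sets it.\<close>

lemma acs_step_size_reciprocal:
  assumes acs: "acs_step_sizes \<epsilon> q I\<^sub>s \<gamma> s" and I: "1 \<le> I\<^sub>s" and k: "1 \<le> k"
  shows "\<exists>j. 1 \<le> j \<and> j \<le> k \<and> s k = 1 / real j"
  using k
proof (induction k rule: dec_induct)
  case base
  then show ?case using acs I by (auto simp: acs_step_sizes_def)
next
  case (step k)
  have "s (Suc k) = 1 / real (Suc k) \<or> s (Suc k) = s k"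
    using acs by (auto simp: acs_step_sizes_def)
  then show ?case using step by (metis le_SucI le_Suc_eq)
qed

lemma acs_step_size_bounds:
  assumes "acs_step_sizes \<epsilon> q I\<^sub>s \<gamma> s" "1 \<le> I\<^sub>s" "1 \<le> k"
  shows "1 / real k \<le> s k" "s k \<le> 1"
  using acs_step_size_reciprocal[OF assms] by (auto simp: frac_le)

text \<open>A reset cannot raise the step size: the new value 1/(k+1) lies below 1/k, and
  \<open>s k\<close> is at least 1/k.\<close>

lemma acs_step_size_decreasing:
  assumes acs: "acs_step_sizes \<epsilon> q I\<^sub>s \<gamma> s" and I: "1 \<le> I\<^sub>s" and jk: "1 \<le> j" "j \<le> k"
  shows "s k \<le> s j"
  using jk(2)
proof (induction k rule: dec_induct)
  case (step k)
  have "s (Suc k) = 1 / real (Suc k) \<or> s (Suc k) = s k"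
    using acs by (auto simp: acs_step_sizes_def)
  moreover have "1 / real (Suc k) \<le> 1 / real k"
    using step jk(1) by (intro divide_left_mono) auto
  ultimately have "s (Suc k) \<le> s k"
    using acs_step_size_bounds(1)[OF acs I, of k] step jk(1) by linarith
  then show ?case using step by linarith
qed simp

lemma acs_step_sizes_not_summable:
  assumes "acs_step_sizes \<epsilon> q I\<^sub>s \<gamma> s" "1 \<le> I\<^sub>s"
  shows "\<not> summable (\<lambda>k. s (Suc k))"
proof
  assume "summable (\<lambda>k. s (Suc k))"
  then have "summable (\<lambda>k. 1 / real (Suc k))"
    by (rule summable_comparison_test'[where N = 0])
      (use acs_step_size_bounds(1)[OF assms, of "Suc _"] in auto)
  then show False
    using not_summable_harmonic[where 'a = real] summable_Suc_iff[of "\<lambda>k. 1 / real k"]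
    by (simp add: inverse_eq_divide)
qed

text \<open>A late reset makes the step size small, and monotonicity keeps it small
  afterwards.\<close>

lemma acs_step_sizes_tendsto_zero:
  assumes acs: "acs_step_sizes \<epsilon> q I\<^sub>s \<gamma> s" and I: "1 \<le> I\<^sub>s"
    and often: "\<forall>N. \<exists>k\<ge>N. acs_reset \<epsilon> q \<gamma> k"
  shows "s \<longlonglongrightarrow> 0"
proof (rule LIMSEQ_I)
  fix r :: real assume r: "0 < r"
  obtain N where N: "1 / r < real N" using reals_Archimedean2 by blast
  obtain k where k: "k \<ge> max 1 N" "acs_reset \<epsilon> q \<gamma> k" using often by blast
  have "1 / r < real k" using N k(1) by linarith
  then have "1 / real k < r" using r k(1) by (simp add: field_simps)
  moreover have "s k = 1 / real k" using acs k by (auto simp: acs_step_sizes_def)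
  ultimately have "\<bar>s n\<bar> < r" if "n \<ge> k" for n
  proof -
    have "0 \<le> s n"
      using acs_step_size_bounds(1)[OF acs I, of n] k(1) that by (meson max.boundedE order_trans zero_le_divide_1_iff of_nat_0_le_iff)
    then show ?thesis
      using acs_step_size_decreasing[OF acs I, of k n] k(1) that \<open>s k = _\<close> \<open>1 / real k < r\<close> by auto
  qed
  then show "\<exists>no. \<forall>n\<ge>no. norm (s n - 0) < r" by auto
qed

text \<open>The quotient in the reset condition is \<open>0\<close> when the oldest gap is \<open>0\<close>, so the absence of
  resets forces positive gaps.\<close>

lemma acs_gap_tendsto_zero:
  assumes \<epsilon>: "0 < \<epsilon>" "\<epsilon> < 1" and q: "1 < q"
    and \<gamma>0: "\<And>k. 1 \<le> k \<Longrightarrow> 0 \<le> \<gamma> k" and \<gamma>B: "\<And>k. 1 \<le> k \<Longrightarrow> \<gamma> k \<le> B"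
    and never: "\<And>k. N \<le> k \<Longrightarrow> \<not> acs_reset \<epsilon> q \<gamma> k"
  shows "\<gamma> \<longlonglongrightarrow> 0"
proof -
  \<comment> \<open>A window of \<open>q\<close> gap values spans \<open>q - 1\<close>
    iterations.\<close>
  define p where "p = q - 1"
  \<comment> \<open>The successor keeps indices at least 1, so that the bounds on
    \<open>\<gamma>\<close> apply and the window ending at \<open>k + p\<close> is full.\<close>
  define M where "M = Suc N"
  have p: "1 \<le> p" "q = Suc p" using q by (auto simp: p_def)
  have contract: "\<gamma> (k + p) \<le> (1 - \<epsilon>) * \<gamma> k" if "M \<le> k" for k
  proof -
    have k: "1 \<le> k" "N \<le> k + p" using that by (auto simp: M_def)
    then have quot: "\<epsilon> \<le> (\<gamma> k - \<gamma> (k + p)) / \<gamma> k"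
      using never[OF k(2)] p by (auto simp: acs_reset_def)
    then have "0 < \<gamma> k" using \<epsilon> \<gamma>0[OF k(1)] by (cases "\<gamma> k = 0") auto
    then show ?thesis using quot by (simp add: field_simps)
  qed
  \<comment> \<open>Leaving \<open>k\<close> arbitrary treats all residues modulo \<open>p\<close>
    at once.\<close>
  have geom: "\<gamma> k \<le> (1 - \<epsilon>) ^ n * B" if "M + n * p \<le> k" for n k
    using that
  proof (induction n arbitrary: k)
    case 0
    then show ?case using \<gamma>B[of k] by (simp add: M_def)
  next
    case (Suc n)
    then have "p \<le> k" "M + n * p \<le> k - p" by auto
    then have "\<gamma> k \<le> (1 - \<epsilon>) * \<gamma> (k - p)" using contract[of "k - p"] by auto
    also have "\<dots> \<le> (1 - \<epsilon>) * ((1 - \<epsilon>) ^ n * B)"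
      using Suc.IH[OF \<open>M + n * p \<le> k - p\<close>] \<epsilon> by (intro mult_left_mono) auto
    finally show ?case by (simp add: mult.assoc)
  qed
  show ?thesis
  proof (rule LIMSEQ_I)
    fix r :: real assume "0 < r"
    have "(\<lambda>n. (1 - \<epsilon>) ^ n * B) \<longlonglongrightarrow> 0"
      using \<epsilon> by (intro tendsto_mult_left_zero LIMSEQ_realpow_zero) auto
    from order_tendstoD(2)[OF this \<open>0 < r\<close>] obtain n where n: "(1 - \<epsilon>) ^ n * B < r"
      by (auto simp: eventually_sequentially)
    have "norm (\<gamma> k - 0) < r" if "M + n * p \<le> k" for k
      using geom[OF that] n \<gamma>0[of k] that by (auto simp: M_def)
    then show "\<exists>no. \<forall>k\<ge>no. norm (\<gamma> k - 0) < r" by blast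
  qed
qed

section \<open>The feasible set\<close>

lemma feasible_nonneg: "h \<in> feasible od W d \<Longrightarrow> 0 \<le> h $ i"
  by (simp add: feasible_def)

lemma feasible_sum:
  "h \<in> feasible od W d \<Longrightarrow> w \<in> W \<Longrightarrow> (\<Sum>i | od i = w. h $ i) = d w"
  by (simp add: feasible_def)

text \<open>Every path belongs to an OD pair in \<open>W\<close>, so its flow is bounded by the
  demand of that pair.\<close>

lemma compact_feasible:
  assumes W: "range od = W"
  shows "compact (feasible od W d)"
proof -
  have "feasible od W d \<subseteq> cbox 0 (\<chi> i. d (od i))"
  proof
    fix h assume h: "h \<in> feasible od W d"
    have "h $ i \<le> d (od i)" for i
      using member_le_sum[of i "{j. od j = od i}" "($) h"] feasible_nonneg[OF h]
        feasible_sum[OF h, of "od i"] W by auto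
    then show "h \<in> cbox 0 (\<chi> i. d (od i))"
      using feasible_nonneg[OF h] by (simp add: mem_box_cart)
  qed
  then have "bounded (feasible od W d)" using bounded_cbox bounded_subset by blast
  moreover have "closed (feasible od W d)"
    unfolding feasible_def Ball_def
    by (intro closed_Collect_conj closed_Collect_all closed_Collect_imp closed_Collect_le
        closed_Collect_eq continuous_intros) auto
  ultimately show ?thesis by (simp add: compact_eq_bounded_closed)
qed

lemma convex_feasible: "convex (feasible od W d)"
proof (rule convexI)
  fix x y and u v :: real
  assume x: "x \<in> feasible od W d" and y: "y \<in> feasible od W d" and uv: "0 \<le> u" "0 \<le> v" "u + v = 1"
  have "(\<Sum>i | od i = w. u * x $ i + v * y $ i) = d w" if "w \<in> W" for w
    using feasible_sum[OF x that] feasible_sum[OF y that] uv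
    by (simp add: sum.distrib flip: sum_distrib_left distrib_right)
  then show "u *\<^sub>R x + v *\<^sub>R y \<in> feasible od W d"
    using feasible_nonneg[OF x] feasible_nonneg[OF y] uv by (simp add: feasible_def)
qed

text \<open>Quantities depending only on the OD pair have the same weighted total at all feasible
  flows; this cancels the logit normalization when two flows are compared.\<close>

lemma feasible_sum_weighted:
  fixes od :: "'p::finite \<Rightarrow> 'w"
  assumes h: "h \<in> feasible od W d" and W: "range od = W"
  shows "(\<Sum>i\<in>UNIV. h $ i * f (od i)) = (\<Sum>w\<in>W. d w * f w)"
proof -
  have "finite W" using W by auto
  then have "(\<Sum>i\<in>UNIV. h $ i * f (od i)) = (\<Sum>w\<in>W. \<Sum>i | od i = w. h $ i * f (od i))"
    using sum.group[of UNIV W od "\<lambda>i. h $ i * f (od i)"] W by simp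
  also have "\<dots> = (\<Sum>w\<in>W. (\<Sum>i | od i = w. h $ i) * f w)"
    by (simp add: sum_distrib_right)
  finally show ?thesis using feasible_sum[OF h] by simp
qed

section \<open>The logit map as an entropy-regularized minimizer\<close>

lemma logit_denominator_pos:
  fixes od :: "'p::finite \<Rightarrow> 'w" and x :: "real ^ 'p"
  shows "0 < (\<Sum>j | od j = od i. exp (- \<theta> * x $ j))"
  by (rule sum_pos) auto

lemma logit_map_feasible:
  fixes od :: "'p::finite \<Rightarrow> 'w"
  assumes h: "h \<in> feasible od W d" and W: "range od = W"
  shows "logit_map links od \<tau> \<theta> h \<in> feasible od W d"
proof -
  define c where "c = path_costs links \<tau> h"
  have "(\<Sum>i | od i = od k. logit_map links od \<tau> \<theta> h $ i) = d (od k)" for k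
  proof -
    have "(\<Sum>i | od i = od k. logit_map links od \<tau> \<theta> h $ i)
        = (\<Sum>i | od i = od k. d (od k) * (exp (- \<theta> * c $ i) / (\<Sum>j | od j = od k. exp (- \<theta> * c $ j))))"
      using feasible_sum[OF h] W
      by (intro sum.cong) (auto simp: logit_map_def logit_prob_def c_def)
    also have "\<dots> = d (od k)"
      using logit_denominator_pos[where od = od and i = k and x = c and \<theta> = \<theta>]
      by (simp flip: sum_distrib_left sum_divide_distrib)
    finally show ?thesis .
  qed
  moreover have "0 \<le> logit_map links od \<tau> \<theta> h $ i" for i
    using feasible_nonneg[OF h] by (auto simp: logit_map_def logit_prob_def intro!: sum_nonneg mult_nonneg_nonneg divide_nonneg_nonneg)
  ultimately show ?thesis using W by (auto simp: feasible_def)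
qed

definition neg_entropy :: "real ^ 'p::finite \<Rightarrow> real" where
  "neg_entropy h = (\<Sum>i\<in>UNIV. h $ i * ln (h $ i))"

lemma neg_entropy_continuous: "continuous_on (feasible od W d) neg_entropy"
  unfolding neg_entropy_def
  by (intro continuous_on_sum continuous_on_compose2[OF mult_ln_continuous] continuous_intros)
    (auto simp: feasible_nonneg)

lemma neg_entropy_convex: "convex_on (feasible od W d) neg_entropy"
proof (rule convex_onI)
  fix t :: real and x y
  assume t: "0 < t" "t < 1" and xy: "x \<in> feasible od W d" "y \<in> feasible od W d"
  have "neg_entropy ((1 - t) *\<^sub>R x + t *\<^sub>R y)
      \<le> (\<Sum>i\<in>UNIV. (1 - t) * (x $ i * ln (x $ i)) + t * (y $ i * ln (y $ i)))"
    unfolding neg_entropy_def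
  proof (rule sum_mono)
    fix i
    show "((1 - t) *\<^sub>R x + t *\<^sub>R y) $ i * ln (((1 - t) *\<^sub>R x + t *\<^sub>R y) $ i)
       \<le> (1 - t) * (x $ i * ln (x $ i)) + t * (y $ i * ln (y $ i))"
      using convex_onD[OF mult_ln_convex, of t "x $ i" "y $ i"] t xy
      by (simp add: feasible_nonneg)
  qed
  then show "neg_entropy ((1 - t) *\<^sub>R x + t *\<^sub>R y) \<le> (1 - t) * neg_entropy x + t * neg_entropy y"
    by (simp add: neg_entropy_def sum.distrib sum_distrib_left)
qed (rule convex_feasible)

text \<open>The difference of the two sides is the Kullback--Leibler divergence of \<open>z\<close> from the logit flow,
  divided by \<open>\<theta>\<close>.\<close>

lemma logit_map_strict_minimizer:
  fixes od :: "'p::finite \<Rightarrow> 'w" and links :: "'p \<Rightarrow> 'l::finite list"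
  assumes \<theta>: "0 < \<theta>" and h: "h \<in> feasible od W d" and z: "z \<in> feasible od W d"
    and W: "range od = W" and ne: "z \<noteq> logit_map links od \<tau> \<theta> h"
  defines "y \<equiv> logit_map links od \<tau> \<theta> h" and "c \<equiv> path_costs links \<tau> h"
  shows "c \<bullet> y + neg_entropy y / \<theta> < c \<bullet> z + neg_entropy z / \<theta>"
proof -
  define Z where "Z w = (\<Sum>j | od j = w. exp (- \<theta> * c $ j))" for w
  \<comment> \<open>The part of the logarithm of the logit flow that depends only on the OD
    pair.\<close>
  define K where "K w = ln (d w) - ln (Z w)" for w
  have y: "y \<in> feasible od W d"
    unfolding y_def by (rule logit_map_feasible[OF h W])
  have Z: "0 < Z (od i)" for i unfolding Z_def by (rule logit_denominator_pos)
  have y_eq: "y $ i = d (od i) * (exp (- \<theta> * c $ i) / Z (od i))" for i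
    using feasible_sum[OF h, of "od i"] W by (auto simp: y_def logit_map_def logit_prob_def c_def Z_def)
  \<comment> \<open>OD pairs without positive demand carry no flow, so their terms vanish and the
    formula \<open>ln_y\<close> is required only for positive demand.\<close>
  have zero: "x $ i = 0" if "x \<in> feasible od W d" "d (od i) \<le> 0" for x i
    using member_le_sum[of i "{j. od j = od i}" "($) x"] feasible_nonneg[OF that(1)]
        feasible_sum[OF that(1), of "od i"] W that(2) by (auto intro: antisym)
  have ln_y: "ln (y $ i) = K (od i) - \<theta> * c $ i" if "0 < d (od i)" for i
    using that Z[of i] by (simp add: y_eq K_def ln_mult ln_div)
  have y_pos: "0 < y $ i" if "0 < d (od i)" for i
    using that Z[of i] by (simp add: y_eq)
  have y_term: "y $ i * ln (y $ i) = y $ i * (K (od i) - \<theta> * c $ i)" for i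
    using ln_y[of i] zero[OF y, of i] by (cases "0 < d (od i)") auto
  have z_term_strict: "z $ i * (K (od i) - \<theta> * c $ i) + z $ i - y $ i < z $ i * ln (z $ i)"
    if "z $ i \<noteq> y $ i" for i
  proof (cases "0 < d (od i)")
    case True
    then show ?thesis
      using mult_ln_gt[OF feasible_nonneg[OF z] y_pos that] by (simp add: ln_y)
  qed (use zero[OF y] zero[OF z] that in auto)
  have z_term: "z $ i * (K (od i) - \<theta> * c $ i) + z $ i - y $ i \<le> z $ i * ln (z $ i)" for i
    using z_term_strict[of i] y_term[of i] by (cases "z $ i = y $ i") auto
  obtain i0 where "z $ i0 \<noteq> y $ i0" using ne unfolding y_def by (metis vec_eq_iff)
  then have "(\<Sum>i\<in>UNIV. z $ i * (K (od i) - \<theta> * c $ i) + z $ i - y $ i) < neg_entropy z"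
    unfolding neg_entropy_def using z_term z_term_strict by (intro sum_strict_mono_ex1) auto
  moreover have "neg_entropy y = (\<Sum>i\<in>UNIV. y $ i * (K (od i) - \<theta> * c $ i))"
    unfolding neg_entropy_def by (simp add: y_term)
  \<comment> \<open>Feasibility of both flows removes \<open>K\<close> and the total flows from the
    comparison, leaving only costs and entropies.\<close>
  moreover have "(\<Sum>i\<in>UNIV. z $ i * K (od i)) = (\<Sum>i\<in>UNIV. y $ i * K (od i))"
    by (simp only: feasible_sum_weighted[OF z W] feasible_sum_weighted[OF y W])
  moreover have "(\<Sum>i\<in>UNIV. z $ i) = (\<Sum>i\<in>UNIV. y $ i)"
    using feasible_sum_weighted[OF z W, of "\<lambda>_. 1"] feasible_sum_weighted[OF y W, of "\<lambda>_. 1"] by simp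
  moreover have "(\<Sum>i\<in>UNIV. x $ i * (K (od i) - \<theta> * c $ i)) = (\<Sum>i\<in>UNIV. x $ i * K (od i)) - \<theta> * (c \<bullet> x)" for x
    by (simp add: inner_vec_def sum_distrib_left sum_subtractf right_diff_distrib mult_ac)
  ultimately have "\<theta> * (c \<bullet> y) + neg_entropy y < \<theta> * (c \<bullet> z) + neg_entropy z"
    by (simp add: sum.distrib sum_subtractf)
  then show ?thesis
    using \<theta> divide_strict_right_mono[OF _ \<theta>] by (fastforce simp: add_divide_distrib)
qed

section \<open>The Beckmann potential and its gradient inequality\<close>

text \<open>A monotone integrand has a convex antiderivative: \<open>f a\<close> bounds
  \<open>f\<close> from below to the right of \<open>a\<close> and from above to the left.\<close>

lemma integral_mono_ge_tangent:
  fixes f :: "real \<Rightarrow> real"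
  assumes cont: "continuous_on {0..} f" and mono: "mono_on {0..} f" and ab: "0 \<le> a" "0 \<le> b"
  shows "f a * (b - a) \<le> integral {0..b} f - integral {0..a} f"
proof -
  have int: "f integrable_on {u..v}" if "0 \<le> u" for u v
    using that by (intro integrable_continuous_real continuous_on_subset[OF cont]) auto
  have split: "integral {0..v} f - integral {0..u} f = integral {u..v} f" if "0 \<le> u" "u \<le> v" for u v
    using Henstock_Kurzweil_Integration.integral_combine[OF that int] by simp
  show ?thesis
  proof (cases "a \<le> b")
    case True
    have "integral {a..b} (\<lambda>_. f a) \<le> integral {a..b} f"
      using ab mono_onD[OF mono] int[of a b] by (intro integral_le) auto
    then show ?thesis using split[of a b] True ab by (simp add: mult.commute)
  next
    case False
    have "integral {b..a} f \<le> integral {b..a} (\<lambda>_. f a)"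
      using ab mono_onD[OF mono] int[of b a] by (intro integral_le) auto
    then show ?thesis using split[of b a] False ab by (simp add: algebra_simps)
  qed
qed

text \<open>Keeps link flows in the domain where the costs are continuous and monotone.\<close>

lemma link_flow_nonneg: "h \<in> feasible od W d \<Longrightarrow> 0 \<le> (incidence links *v h) $ l"
  by (auto simp: matrix_vector_mult_def incidence_def feasible_nonneg intro!: sum_nonneg)

definition beckmann ::
  "('p::finite \<Rightarrow> 'l::finite list) \<Rightarrow> ('l \<Rightarrow> real \<Rightarrow> real) \<Rightarrow> real ^ 'p \<Rightarrow> real" where
  "beckmann links \<tau> h = (\<Sum>l\<in>UNIV. integral {0..(incidence links *v h) $ l} (\<tau> l))"

text \<open>Moving the transposed incidence matrix across the inner product reduces the claim to one
  tangent inequality per link, since each cost depends on its own flow.\<close>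

lemma beckmann_subgradient:
  assumes cont: "\<And>l. continuous_on {0..} (\<tau> l)" and mono: "\<And>l. mono_on {0..} (\<tau> l)"
    and a: "a \<in> feasible od W d" and b: "b \<in> feasible od W d"
  shows "path_costs links \<tau> a \<bullet> (b - a) \<le> beckmann links \<tau> b - beckmann links \<tau> a"
proof -
  let ?D = "incidence links"
  have "path_costs links \<tau> a \<bullet> (b - a) = (\<chi> l. \<tau> l ((?D *v a) $ l)) \<bullet> (?D *v b - ?D *v a)"
    by (simp add: path_costs_def dot_lmul_matrix matrix_vector_mult_diff_distrib)
  also have "\<dots> = (\<Sum>l\<in>UNIV. \<tau> l ((?D *v a) $ l) * ((?D *v b) $ l - (?D *v a) $ l))"
    by (simp add: inner_vec_def)
  also have "\<dots> \<le> (\<Sum>l\<in>UNIV. integral {0..(?D *v b) $ l} (\<tau> l) - integral {0..(?D *v a) $ l} (\<tau> l))"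
    by (intro sum_mono integral_mono_ge_tangent cont mono link_flow_nonneg[OF a] link_flow_nonneg[OF b])
  finally show ?thesis by (simp add: beckmann_def sum_subtractf)
qed

lemma path_costs_continuous:
  assumes "\<And>l. continuous_on {0..} (\<tau> l)"
  shows "continuous_on (feasible od W d) (path_costs links \<tau>)"
  unfolding path_costs_def
  by (intro linear_continuous_on_compose[OF _ matrix_vector_mul_linear] continuous_on_vec_lambda
      continuous_on_compose2[OF assms] continuous_on_component matrix_vector_mult_linear_continuous_on)
    (auto simp: link_flow_nonneg)

section \<open>Convergence of the ACS iterates in both reset regimes\<close>

theorem theorem3:
  fixes G :: "('v, 'l::finite) pre_digraph"
    and W :: "('v \<times> 'v) set"
    and d :: "'v \<times> 'v \<Rightarrow> real"
    and od :: "'p::finite \<Rightarrow> 'v \<times> 'v"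
    and links :: "'p \<Rightarrow> 'l list"
    and \<tau> :: "'l \<Rightarrow> real \<Rightarrow> real"
    and \<theta> \<epsilon> :: real
    and q I\<^sub>s :: nat
    and g :: "real ^ 'p \<Rightarrow> real"
    and h_hat :: "real ^ 'p"
    and h :: "nat \<Rightarrow> real ^ 'p"
    and s :: "nat \<Rightarrow> real"
  assumes "road_network G W d od links \<tau>"
    and "\<theta> > 0"
    and "is_sue links od W d \<tau> \<theta> h_hat"
    and "\<forall>x\<in>feasible od W d. g x \<ge> 0 \<and> (g x = 0 \<longleftrightarrow> x = h_hat)"
    and "continuous_on (feasible od W d) g"
    and "0 < \<epsilon>" "\<epsilon> < 1" "q > 1" "I\<^sub>s > 1"
    and "h 1 \<in> feasible od W d"
    and "acs_step_sizes \<epsilon> q I\<^sub>s (\<lambda>k. g (h k)) s"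
    and "msa_iterates (logit_map links od \<tau> \<theta>) s h"
  shows "h \<longlonglongrightarrow> h_hat"
proof -
  interpret road_network G W d od links \<tau> by fact
  let ?X = "feasible od W d" and ?F = "logit_map links od \<tau> \<theta>"
  note W = od_surj
  note acs = assms(11)
  have I: "1 \<le> I\<^sub>s" using assms(9) by simp
  have X: "compact ?X" by (rule compact_feasible[OF W])
  have sue: "h_hat \<in> ?X" "?F h_hat = h_hat" using assms(3) by (auto simp: is_sue_def)
  have cont: "continuous_on {0..} (\<tau> l)" for l
    using cost_C2[of l] by (metis atLeast_iff has_field_derivative_imp_has_derivative has_derivative_continuous_on)
  have step: "h (Suc k) = (1 - s k) *\<^sub>R h k + s k *\<^sub>R ?F (h k)" if "1 \<le> k" for k
    using assms(12) that by (simp add: msa_iterates_def)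
  have s01: "0 \<le> s k" "s k \<le> 1" if "1 \<le> k" for k
    using acs_step_size_bounds[OF acs I that] by (auto intro: order_trans[rotated])
  have hX: "h k \<in> ?X" if "1 \<le> k" for k
    using that
  proof (induction k rule: dec_induct)
    case (step k)
    then show ?case
      using convexD_alt[OF convex_feasible step.IH logit_map_feasible[OF step.IH W]] s01[of k]
        assms(12) by (simp add: msa_iterates_def)
  qed (use assms(10) in simp)
  show ?thesis
  proof (cases "\<forall>N. \<exists>k\<ge>N. acs_reset \<epsilon> q (\<lambda>k. g (h k)) k")
    case True
    \<comment> \<open>The shift matches iterations numbered from 1 with the general result, indexed
      from 0.\<close>
    have "(\<lambda>k. h (Suc k)) \<longlonglongrightarrow> h_hat"
    proof (rule generalized_conditional_gradient[where X = ?X and C = "path_costs links \<tau>"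
            and F = ?F and \<Phi> = "beckmann links \<tau>" and R = "\<lambda>x. neg_entropy x / \<theta>"
            and s = "\<lambda>k. s (Suc k)"])
      show "convex_on ?X (\<lambda>x. neg_entropy x / \<theta>)"
        using convex_on_cmul[OF _ neg_entropy_convex, of "1 / \<theta>" od W d] assms(2) by simp
      show "continuous_on ?X (\<lambda>x. neg_entropy x / \<theta>)"
        using assms(2) by (intro continuous_intros neg_entropy_continuous) auto
      show "path_costs links \<tau> a \<bullet> ?F a + neg_entropy (?F a) / \<theta>
          \<le> path_costs links \<tau> a \<bullet> b + neg_entropy b / \<theta>" if "a \<in> ?X" "b \<in> ?X" for a b
        using logit_map_strict_minimizer[OF assms(2) that W, of links \<tau>]
        by (cases "b = ?F a") auto
      \<comment> \<open>As a fixed point, \<open>h_hat\<close> is itself the strict minimizer of the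
        objective linearized at \<open>h_hat\<close>.\<close>
      show "path_costs links \<tau> h_hat \<bullet> h_hat + neg_entropy h_hat / \<theta>
          < path_costs links \<tau> h_hat \<bullet> b + neg_entropy b / \<theta>" if "b \<in> ?X" "b \<noteq> h_hat" for b
        using logit_map_strict_minimizer[OF assms(2) sue(1) that(1) W, of links \<tau>] that(2) sue(2)
        by simp
      show "(\<lambda>k. s (Suc k)) \<longlonglongrightarrow> 0"
        using acs_step_sizes_tendsto_zero[OF acs I True] by (rule LIMSEQ_Suc)
    qed (use X sue(1) hX s01 step cont cost_mono acs_step_sizes_not_summable[OF acs I]
          path_costs_continuous[OF cont] beckmann_subgradient[OF cont] logit_map_feasible[OF _ W]
          in auto)
    then show ?thesis by (rule LIMSEQ_imp_Suc)
  next
    case False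
    then obtain N where N: "\<And>k. N \<le> k \<Longrightarrow> \<not> acs_reset \<epsilon> q (\<lambda>k. g (h k)) k" by blast
    \<comment> \<open>Provides the initial bound for the geometric decay of the gaps.\<close>
    have "bounded (g ` ?X)"
      using compact_continuous_image[OF assms(5) X] by (rule compact_imp_bounded)
    then obtain B where "\<And>x. x \<in> ?X \<Longrightarrow> g x \<le> B"
      unfolding bounded_iff by (metis imageI real_norm_def abs_le_D1)
    then have "(\<lambda>k. g (h k)) \<longlonglongrightarrow> 0"
      using hX assms(4) N by (intro acs_gap_tendsto_zero[OF assms(6-8)]) auto
    then have "(\<lambda>k. g (h (Suc k))) \<longlonglongrightarrow> 0" by (rule LIMSEQ_Suc)
    then have "(\<lambda>k. h (Suc k)) \<longlonglongrightarrow> h_hat"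
      using assms(4) hX by (intro tendsto_of_gap_tendsto_zero[OF X assms(5)]) (auto simp: less_le)
    then show ?thesis by (rule LIMSEQ_imp_Suc)
  qed
qed

end
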